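(* Let $I\subset\mathbb{R}$ be an interval, let $p\in\mathbb{N}$ with $p>1$, let $\mathbf{M}\colon I^p\to I^p$ be a mean-type mapping, and let $K\colon I^p\to I$ be an arbitrary mean. Then $K$ is the unique $\mathbf{M}$-invariant mean (that is, $K$ is $\mathbf{M}$-invariant and every $\mathbf{M}$-invariant mean $I^p\to I$ equals $K$) if and only if the sequence of iterates $(\mathbf{M}^n)_{n\in\mathbb{N}}$ converges to $\mathbf{K}:=(K,\dots,K)$ pointwise on $I^p$.
   Context: A function $M\colon I^p\to I$ is called a mean (in $I$) if $\min(v_1,\dots,v_p)\le M(v_1,\dots,v_p)\le \max(v_1,\dots,v_p)$ for all $v_1,\dots,v_p\in I$; no regularity (e.g. continuity) is assumed. A mapping $\mathbf{M}\colon I^p\to I^p$ is called mean-type if $\mathbf{M}=(M_1,\dots,M_p)$ for some means $M_1,\dots,M_p\colon I^p\to I$. A function $K\colon I^p\to\mathbb{R}$ is $\mathbf{M}$-invariant if $K\circ\mathbf{M}=K$. $\mathbf{M}^n$ denotes the $n$-th iterate of $\mathbf{M}$ under composition. *)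

theory Defs
  imports "HOL-Analysis.Analysis"
begin

text \<open>
  The arity \<open>p\<close> is the cardinality of the finite index type \<open>'p\<close>. Functions on
  \<open>I\<^sup>p\<close> are total HOL functions; only their values on \<open>I\<^sup>p\<close> are constrained, and equality
  of such functions means equality on \<open>I\<^sup>p\<close>.
\<close>

definition vec_power :: "real set \<Rightarrow> (real ^ 'p) set" where
  "vec_power I = {v. \<forall>i. v $ i \<in> I}"

definition is_mean :: "real set \<Rightarrow> (real ^ 'p \<Rightarrow> real) \<Rightarrow> bool" where
  "is_mean I M \<longleftrightarrow> M \<in> vec_power I \<rightarrow> I \<and>
     (\<forall>v \<in> vec_power I. Min (range (\<lambda>i. v $ i)) \<le> M v \<and> M v \<le> Max (range (\<lambda>i. v $ i)))"

definition mean_type :: "real set \<Rightarrow> (real ^ 'p \<Rightarrow> real ^ 'p) \<Rightarrow> bool" where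
  "mean_type I M \<longleftrightarrow>
     (\<exists>m :: 'p \<Rightarrow> real ^ 'p \<Rightarrow> real.
        (\<forall>i. is_mean I (m i)) \<and> (\<forall>v \<in> vec_power I. M v = (\<chi> i. m i v)))"

definition invariant_under ::
    "real set \<Rightarrow> (real ^ 'p \<Rightarrow> real ^ 'p) \<Rightarrow> (real ^ 'p \<Rightarrow> real) \<Rightarrow> bool" where
  "invariant_under I M K \<longleftrightarrow> (\<forall>v \<in> vec_power I. (K \<circ> M) v = K v)"

definition unique_invariant_mean ::
    "real set \<Rightarrow> (real ^ 'p \<Rightarrow> real ^ 'p) \<Rightarrow> (real ^ 'p \<Rightarrow> real) \<Rightarrow> bool" where
  "unique_invariant_mean I M K \<longleftrightarrow>
     is_mean I K \<and> invariant_under I M K \<and>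
     (\<forall>L. is_mean I L \<and> invariant_under I M L \<longrightarrow> (\<forall>v \<in> vec_power I. L v = K v))"

end

theory Submission
  imports Defs
begin

text \<open>
  Along an orbit of a mean-type mapping the smallest entry increases and the largest entry
  decreases, so both converge. As functions of the starting point, the two limits are themselves
  invariant means (\<open>invariant_mean_lim_iterates\<close>, applied to the means minimum and maximum): they
  lie between the extreme entries of the starting point, hence in the interval, and moving one step
  along the orbit does not change a limit. If the invariant mean is unique, the two limits agree
  with it, and every entry of the orbit is squeezed between them.

  Conversely, a mean differs from a constant \<open>c\<close> by at most the distance of its argument from the
  diagonal point \<open>(c, \<dots>, c)\<close> (\<open>mean_dist_le\<close>). So every mean, continuous or not, is continuous at
  diagonal points. An invariant mean is constant along orbits; if they converge to the
  diagonal point with entries \<open>K v\<close>, that constant can only be \<open>K v\<close>.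
\<close>

definition min_entry :: "real ^ 'p \<Rightarrow> real" where
  "min_entry v = Min (range (\<lambda>i. v $ i))"

definition max_entry :: "real ^ 'p \<Rightarrow> real" where
  "max_entry v = Max (range (\<lambda>i. v $ i))"

lemma min_entry_le: "min_entry v \<le> v $ i"
  unfolding min_entry_def by (rule Min_le) auto

lemma max_entry_ge: "v $ i \<le> max_entry v"
  unfolding max_entry_def by (rule Max_ge) auto

lemma min_entry_attained: "\<exists>i. min_entry v = v $ i"
proof -
  have "min_entry v \<in> range (\<lambda>i. v $ i)"
    unfolding min_entry_def by (rule Min_in) auto
  then show ?thesis by blast
qed

lemma max_entry_attained: "\<exists>i. max_entry v = v $ i"
proof -
  have "max_entry v \<in> range (\<lambda>i. v $ i)"
    unfolding max_entry_def by (rule Max_in) auto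
  then show ?thesis by blast
qed

lemma is_mean_iff:
  "is_mean I S \<longleftrightarrow>
    (\<forall>v \<in> vec_power I. S v \<in> I \<and> min_entry v \<le> S v \<and> S v \<le> max_entry v)"
  unfolding is_mean_def min_entry_def max_entry_def by auto

lemma is_mean_min_entry: "is_mean I min_entry"
  unfolding is_mean_iff vec_power_def
  by (metis (mono_tags, lifting) mem_Collect_eq max_entry_ge min_entry_attained order_refl)

lemma is_mean_max_entry: "is_mean I max_entry"
  unfolding is_mean_iff vec_power_def
  by (metis (mono_tags, lifting) mem_Collect_eq max_entry_attained min_entry_le order_refl)

text \<open>
  A mean takes a value between two entries of \<open>v\<close>, and the norm bounds the deviation of each entry
  from \<open>c\<close>.
\<close>

lemma mean_dist_le:
  assumes "is_mean I S" and "v \<in> vec_power I"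
  shows "\<bar>S v - c\<bar> \<le> norm (v - (\<chi> i. c))"
proof -
  have entry: "\<bar>v $ i - c\<bar> \<le> norm (v - (\<chi> i. c))" for i
    using component_le_norm_cart[of "v - (\<chi> i. c)" i] by simp
  obtain i j where "min_entry v = v $ i" "max_entry v = v $ j"
    using min_entry_attained max_entry_attained by meson
  then show ?thesis
    using assms entry[of i] entry[of j] unfolding is_mean_iff by fastforce
qed

lemma mean_type_entry_bounds:
  assumes "mean_type I M" and "v \<in> vec_power I"
  shows "M v $ i \<in> I" "min_entry v \<le> M v $ i" "M v $ i \<le> max_entry v"
  using assms unfolding mean_type_def is_mean_iff by auto

lemma mean_type_in_vec_power:
  assumes "mean_type I M" and "v \<in> vec_power I"
  shows "M v \<in> vec_power I"
  using mean_type_entry_bounds(1)[OF assms] by (simp add: vec_power_def)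

lemma iterate_in_vec_power:
  assumes "mean_type I M" and "v \<in> vec_power I"
  shows "(M ^^ n) v \<in> vec_power I"
  using assms by (induction n) (auto intro: mean_type_in_vec_power)

lemma min_entry_iterates_incseq:
  assumes "mean_type I M" and "v \<in> vec_power I"
  shows "incseq (\<lambda>n. min_entry ((M ^^ n) v))"
proof (rule incseq_SucI)
  fix n
  show "min_entry ((M ^^ n) v) \<le> min_entry ((M ^^ Suc n) v)"
    using mean_type_entry_bounds(2)[OF assms(1) iterate_in_vec_power[OF assms]]
      min_entry_attained[of "(M ^^ Suc n) v"] by auto
qed

lemma max_entry_iterates_decseq:
  assumes "mean_type I M" and "v \<in> vec_power I"
  shows "decseq (\<lambda>n. max_entry ((M ^^ n) v))"
proof (rule decseq_SucI)
  fix n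
  show "max_entry ((M ^^ Suc n) v) \<le> max_entry ((M ^^ n) v)"
    using mean_type_entry_bounds(3)[OF assms(1) iterate_in_vec_power[OF assms]]
      max_entry_attained[of "(M ^^ Suc n) v"] by auto
qed

lemma mean_iterate_bounds:
  assumes "mean_type I M" and "v \<in> vec_power I" and "is_mean I S"
  shows "min_entry v \<le> S ((M ^^ n) v)" "S ((M ^^ n) v) \<le> max_entry v"
proof -
  have "min_entry ((M ^^ n) v) \<le> S ((M ^^ n) v)" "S ((M ^^ n) v) \<le> max_entry ((M ^^ n) v)"
    using assms(3) iterate_in_vec_power[OF assms(1,2)] unfolding is_mean_iff by blast+
  then show "min_entry v \<le> S ((M ^^ n) v)" "S ((M ^^ n) v) \<le> max_entry v"
    using incseqD[OF min_entry_iterates_incseq[OF assms(1,2)], of 0 n]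
      decseqD[OF max_entry_iterates_decseq[OF assms(1,2)], of 0 n] by auto
qed

lemma min_entry_iterates_convergent:
  assumes "mean_type I M" and "v \<in> vec_power I"
  shows "convergent (\<lambda>n. min_entry ((M ^^ n) v))"
  using incseq_convergent[OF min_entry_iterates_incseq[OF assms], of "max_entry v"]
    mean_iterate_bounds(2)[OF assms is_mean_min_entry]
  unfolding convergent_def by blast

lemma max_entry_iterates_convergent:
  assumes "mean_type I M" and "v \<in> vec_power I"
  shows "convergent (\<lambda>n. max_entry ((M ^^ n) v))"
  using decseq_convergent[OF max_entry_iterates_decseq[OF assms], of "min_entry v"]
    mean_iterate_bounds(1)[OF assms is_mean_max_entry]
  unfolding convergent_def by blast

text \<open>
  The limit of a mean along orbits inherits the bounds by the extreme entries of the starting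
  point; since the domain is an interval, these bounds also keep the limit inside it. Invariance
  holds because the orbit of \<open>M v\<close> is the orbit of \<open>v\<close> shifted by one.
\<close>

lemma invariant_mean_lim_iterates:
  assumes "is_interval I" and M: "mean_type I M" and S: "is_mean I S"
    and conv: "\<And>v. v \<in> vec_power I \<Longrightarrow> convergent (\<lambda>n. S ((M ^^ n) v))"
  shows "is_mean I (\<lambda>v. lim (\<lambda>n. S ((M ^^ n) v)))"
    and "invariant_under I M (\<lambda>v. lim (\<lambda>n. S ((M ^^ n) v)))"
proof -
  let ?L = "\<lambda>v. lim (\<lambda>n. S ((M ^^ n) v))"
  show "is_mean I ?L"
    unfolding is_mean_iff
  proof
    fix v :: "real ^ 'a" assume v: "v \<in> vec_power I"
    have tends: "(\<lambda>n. S ((M ^^ n) v)) \<longlonglongrightarrow> ?L v"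
      using conv[OF v] by (simp add: convergent_LIMSEQ_iff)
    have lower: "min_entry v \<le> ?L v"
      using mean_iterate_bounds(1)[OF M v S] by (intro LIMSEQ_le_const[OF tends]) blast
    have upper: "?L v \<le> max_entry v"
      using mean_iterate_bounds(2)[OF M v S] by (intro LIMSEQ_le_const2[OF tends]) blast
    have "min_entry v \<in> I" "max_entry v \<in> I"
      using is_mean_min_entry[of I] is_mean_max_entry[of I] v unfolding is_mean_iff by blast+
    then have "?L v \<in> I"
      using \<open>is_interval I\<close> lower upper unfolding is_interval_1 by blast
    then show "?L v \<in> I \<and> min_entry v \<le> ?L v \<and> ?L v \<le> max_entry v"
      using lower upper by blast
  qed
  show "invariant_under I M ?L"
    unfolding invariant_under_def
  proof
    fix v :: "real ^ 'a" assume v: "v \<in> vec_power I"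
    have "(\<lambda>n. S ((M ^^ n) v)) \<longlonglongrightarrow> ?L v"
      using conv[OF v] by (simp add: convergent_LIMSEQ_iff)
    then have "(\<lambda>n. S ((M ^^ n) (M v))) \<longlonglongrightarrow> ?L v"
      using LIMSEQ_Suc by (fastforce simp: funpow_swap1)
    then show "(?L \<circ> M) v = ?L v"
      by (simp add: limI)
  qed
qed

lemma invariant_iterate:
  assumes "mean_type I M" and "invariant_under I M L" and "v \<in> vec_power I"
  shows "L ((M ^^ n) v) = L v"
proof (induction n)
  case (Suc n)
  then show ?case
    using assms(2) iterate_in_vec_power[OF assms(1,3), of n]
    unfolding invariant_under_def by simp
qed simp

lemma invariant_mean_eq_diagonal_limit:
  assumes "mean_type I M" and "is_mean I L" and "invariant_under I M L"
    and v: "v \<in> vec_power I" and lim: "(\<lambda>n. (M ^^ n) v) \<longlonglongrightarrow> (\<chi> i. c)"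
  shows "L v = c"
proof -
  have bound: "\<bar>L v - c\<bar> \<le> norm ((M ^^ n) v - (\<chi> i. c))" for n
    using mean_dist_le[OF assms(2) iterate_in_vec_power[OF assms(1) v], of n c]
      invariant_iterate[OF assms(1,3) v, of n] by simp
  have "(\<lambda>n. norm ((M ^^ n) v - (\<chi> i. c))) \<longlonglongrightarrow> 0"
    using tendsto_norm_zero[OF LIM_zero[OF lim]] .
  then have "\<bar>L v - c\<bar> \<le> 0"
    using bound by (intro LIMSEQ_le_const) auto
  then show ?thesis by simp
qed

lemma unique_invariant_mean_imp_iterates_tendsto:
  assumes I: "is_interval I" and M: "mean_type I M"
    and K: "unique_invariant_mean I M K" and v: "v \<in> vec_power I"
  shows "(\<lambda>n. (M ^^ n) v) \<longlonglongrightarrow> (\<chi> i. K v)"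
proof (rule vec_tendstoI)
  fix i
  have unique: "L v = K v" if "is_mean I L" "invariant_under I M L" for L
    using K v that unfolding unique_invariant_mean_def by blast
  have "lim (\<lambda>n. min_entry ((M ^^ n) v)) = K v"
    using unique[OF invariant_mean_lim_iterates[OF I M is_mean_min_entry]]
      min_entry_iterates_convergent[OF M] by blast
  then have lower: "(\<lambda>n. min_entry ((M ^^ n) v)) \<longlonglongrightarrow> K v"
    using min_entry_iterates_convergent[OF M v] by (simp add: convergent_LIMSEQ_iff)
  have "lim (\<lambda>n. max_entry ((M ^^ n) v)) = K v"
    using unique[OF invariant_mean_lim_iterates[OF I M is_mean_max_entry]]
      max_entry_iterates_convergent[OF M] by blast
  then have upper: "(\<lambda>n. max_entry ((M ^^ n) v)) \<longlonglongrightarrow> K v"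
    using max_entry_iterates_convergent[OF M v] by (simp add: convergent_LIMSEQ_iff)
  have "(\<lambda>n. (M ^^ n) v $ i) \<longlonglongrightarrow> K v"
    by (rule tendsto_sandwich[OF _ _ lower upper]) (simp_all add: min_entry_le max_entry_ge)
  then show "(\<lambda>n. (M ^^ n) v $ i) \<longlonglongrightarrow> (\<chi> i. K v) $ i"
    by simp
qed

text \<open>
  Invariance of the limit again comes from the shift: the orbits of \<open>v\<close> and of \<open>M v\<close> have the same
  limit, so the diagonal points for \<open>K v\<close> and \<open>K (M v)\<close> coincide.
\<close>

lemma iterates_tendsto_imp_unique_invariant_mean:
  assumes M: "mean_type I M" and K: "is_mean I K"
    and lim: "\<And>v. v \<in> vec_power I \<Longrightarrow> (\<lambda>n. (M ^^ n) v) \<longlonglongrightarrow> (\<chi> i. K v)"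
  shows "unique_invariant_mean I M K"
proof -
  have "K (M v) = K v" if v: "v \<in> vec_power I" for v
  proof -
    have "(\<lambda>n. (M ^^ n) (M v)) \<longlonglongrightarrow> (\<chi> i. K v)"
      using LIMSEQ_Suc[OF lim[OF v]] by (simp add: funpow_swap1)
    then have "(\<chi> i. K (M v)) = ((\<chi> i. K v) :: real ^ 'a)"
      using lim[OF mean_type_in_vec_power[OF M v]] LIMSEQ_unique by blast
    then show ?thesis
      by (simp add: vec_eq_iff)
  qed
  then have "invariant_under I M K"
    unfolding invariant_under_def by simp
  then show ?thesis
    using K invariant_mean_eq_diagonal_limit[OF M] lim
    unfolding unique_invariant_mean_def by blast
qed

theorem theorem1:
  fixes I :: "real set"
    and M :: "real ^ 'p \<Rightarrow> real ^ 'p"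
    and K :: "real ^ 'p \<Rightarrow> real"
  assumes "is_interval I"
    and "CARD('p) > 1"
    and "mean_type I M"
    and "is_mean I K"
  shows "unique_invariant_mean I M K \<longleftrightarrow>
    (\<forall>v \<in> vec_power I. (\<lambda>n. (M ^^ n) v) \<longlonglongrightarrow> (\<chi> i. K v))"
  using unique_invariant_mean_imp_iterates_tendsto[OF assms(1,3)]
    iterates_tendsto_imp_unique_invariant_mean[OF assms(3,4)] by blast

end
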